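(* Let $L_s=-\partial^2+u_s$ be an algebro-geometric Schrödinger operator with spectral curve $\Gamma_s$ and nonconstant potential $u_s$, and let $K=C\langle u_s\rangle$. Fix $(\lambda_0,0)\in Z_s$. Given nonzero solutions $y_0$ of $(\partial-\phi_0)y=0$ and $y_1$ of $\partial(y)-\phi_0y=y_0^{-1}$, there is a chain of Liouvillian extensions $$K\subset K\langle y_0\rangle\subset K\langle y_0,y_1\rangle$$ with field of constants $C$, and then $K\langle y_0,y_1\rangle$ is the Picard-Vessiot extension of $(L_s-\lambda_0)y=0$ over $K$.
   Context: $(\Sigma,\partial)$ is a differential field of characteristic zero whose field of constants $C$ is algebraically closed. An operator $L\in\Sigma[\partial]\setminus C[\partial]$ of order $n$ is algebro-geometric if some $P\in\Sigma[\partial]$ of order relatively prime to $n$ satisfies $[L,P]=0$. Let $L_s=-\partial^2+u_s$ with $u_s\in\Sigma\setminus C$ be algebro-geometric. Then there is a unique monic operator $A_{2s+1}$ of minimal order $2s+1$ (minimal among operators of the centralizer not in $C[L_s]$) such that the centralizer of $L_s$ in $\Sigma[\partial]$ is $C[L_s,A_{2s+1}]$ and $A_{2s+1}^2+R_{2s+1}(L_s)=0$ with $R_{2s+1}\in C[\lambda]$ of degree $2s+1$; $A_{2s+1}$ is the partner of $L_s$ and $s$ the level. $K=C\langle u_s\rangle$ is the differential subfield of $\Sigma$ generated by $C$ and $u_s$; $L_s,A_{2s+1}\in K[\partial]$. The spectral curve is $\Gamma_s=\{(\lambda,\mu)\in C^2: \mu^2+R_{2s+1}(\lambda)=0\}$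 and $Z_s=\Gamma_s\cap(C\times\{0\})=\{(\lambda,0): R_{2s+1}(\lambda)=0\}$. For every $P_0=(\lambda_0,\mu_0)\in\Gamma_s$ (here $\mu_0=0$) the greatest common right divisor of $L_s-\lambda_0$ and $A_{2s+1}-\mu_0$ in $K[\partial]$ has order one; its monic form is written $\partial-\phi_0$ with $\phi_0\in K$, and $L_s-\lambda_0=(-\partial-\phi_0)(\partial-\phi_0)$. Solutions are taken in a differential closure of $K$; $\langle\,\cdot\,\rangle$ denotes the generated differential field extension. A Liouvillian extension of a differential field $F$ is $F(t_1,\dots,t_n)$ where each $t_i$ is, over $F(t_1,\dots,t_{i-1})$, algebraic, or primitive ($\partial t_i$ lies in that field), or hyperexponential ($\partial t_i/t_i$ lies in that field). A Picard-Vessiot extension of $K$ for $(L_s-\lambda_0)y=0$ is a differential field generated over $K$ by a fundamental set of two solutions, whose field of constants is that of $K$, namely $C$. *)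

theory Defs
  imports Complex_Main "HOL-Computational_Algebra.Polynomial" "HOL-Library.Poly_Mapping"
begin

text \<open>An ambient differential field is a whole type with a derivation on it; its subfields are sets.\<close>

definition derivation :: "('a::field \<Rightarrow> 'a) \<Rightarrow> bool" where
  "derivation D \<longleftrightarrow> (\<forall>x y. D (x + y) = D x + D y) \<and> (\<forall>x y. D (x * y) = D x * y + x * D y)"

definition constants_in :: "('a::field \<Rightarrow> 'a) \<Rightarrow> 'a set \<Rightarrow> 'a set" where
  "constants_in D F = {x \<in> F. D x = 0}"

abbreviation constants :: "('a::field \<Rightarrow> 'a) \<Rightarrow> 'a set" where
  "constants D \<equiv> constants_in D UNIV"

definition is_subfield :: "'a::field set \<Rightarrow> bool" where
  "is_subfield F \<longleftrightarrow> 0 \<in> F \<and> 1 \<in> F \<and> (\<forall>x\<in>F. \<forall>y\<in>F. x + y \<in> F \<and> x * y \<in> F) \<and>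
     (\<forall>x\<in>F. - x \<in> F \<and> inverse x \<in> F)"

definition diff_subfield :: "('a::field \<Rightarrow> 'a) \<Rightarrow> 'a set \<Rightarrow> bool" where
  "diff_subfield D F \<longleftrightarrow> is_subfield F \<and> (\<forall>x\<in>F. D x \<in> F)"

text \<open>\<open>field_adjoin F S\<close> is $F(S)$ and \<open>diff_adjoin D F S\<close> is $F\langle S\rangle$.\<close>

definition field_adjoin :: "'a::field set \<Rightarrow> 'a set \<Rightarrow> 'a set" where
  "field_adjoin F S = \<Inter>{E. is_subfield E \<and> F \<union> S \<subseteq> E}"

definition diff_adjoin :: "('a::field \<Rightarrow> 'a) \<Rightarrow> 'a set \<Rightarrow> 'a set \<Rightarrow> 'a set" where
  "diff_adjoin D F S = \<Inter>{E. diff_subfield D E \<and> F \<union> S \<subseteq> E}"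

definition polys_over :: "'a::zero set \<Rightarrow> 'a poly set" where
  "polys_over F = {p. \<forall>i. coeff p i \<in> F}"

definition alg_closed_set :: "'a::field set \<Rightarrow> bool" where
  "alg_closed_set F \<longleftrightarrow> (\<forall>p\<in>polys_over F. degree p > 0 \<longrightarrow> (\<exists>x\<in>F. poly p x = 0))"

definition algebraic_over :: "'a::field set \<Rightarrow> 'a \<Rightarrow> bool" where
  "algebraic_over F t \<longleftrightarrow> (\<exists>p\<in>polys_over F. p \<noteq> 0 \<and> poly p t = 0)"

definition diff_embedding ::
    "('a::field \<Rightarrow> 'a) \<Rightarrow> ('b::field \<Rightarrow> 'b) \<Rightarrow> 'a set \<Rightarrow> ('a \<Rightarrow> 'b) \<Rightarrow> bool" where
  "diff_embedding D D' K \<iota> \<longleftrightarrow> \<iota> 1 = 1 \<and>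
     (\<forall>x\<in>K. \<forall>y\<in>K. \<iota> (x + y) = \<iota> x + \<iota> y \<and> \<iota> (x * y) = \<iota> x * \<iota> y) \<and>
     (\<forall>x\<in>K. \<iota> (D x) = D' (\<iota> x))"

definition liouvillian_element :: "('a::field \<Rightarrow> 'a) \<Rightarrow> 'a set \<Rightarrow> 'a \<Rightarrow> bool" where
  "liouvillian_element D F t \<longleftrightarrow>
     algebraic_over F t \<or> D t \<in> F \<or> (t \<noteq> 0 \<and> D t / t \<in> F)"

definition liouvillian_extension :: "('a::field \<Rightarrow> 'a) \<Rightarrow> 'a set \<Rightarrow> 'a set \<Rightarrow> bool" where
  "liouvillian_extension D F E \<longleftrightarrow>
     (\<exists>ts. E = field_adjoin F (set ts) \<and>
       (\<forall>i<length ts. liouvillian_element D (field_adjoin F (set (take i ts))) (ts ! i)))"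

text \<open>The operator $\sum_i p_i\partial^i$ is represented by the polynomial with coefficients \<open>p\<^sub>i\<close>,
  so that its order is the \<open>degree\<close>; sums are those of \<open>'a poly\<close>, but the product is
  \<open>op_mult\<close>, determined by $\partial\cdot q = q\,\partial + D(q)$ for \<open>q\<close> in the field.\<close>

definition partial_times :: "('a::field \<Rightarrow> 'a) \<Rightarrow> 'a poly \<Rightarrow> 'a poly" where
  "partial_times D Q = map_poly D Q + pCons 0 Q"

definition op_mult :: "('a::field \<Rightarrow> 'a) \<Rightarrow> 'a poly \<Rightarrow> 'a poly \<Rightarrow> 'a poly" where
  "op_mult D P Q = (\<Sum>i\<le>degree P. smult (coeff P i) ((partial_times D ^^ i) Q))"

definition op_power :: "('a::field \<Rightarrow> 'a) \<Rightarrow> 'a poly \<Rightarrow> nat \<Rightarrow> 'a poly" where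
  "op_power D P n = (op_mult D P ^^ n) 1"

text \<open>\<open>op_subst D R L\<close> is $R(L)$.\<close>

definition op_subst :: "('a::field \<Rightarrow> 'a) \<Rightarrow> 'a poly \<Rightarrow> 'a poly \<Rightarrow> 'a poly" where
  "op_subst D R L = (\<Sum>i\<le>degree R. smult (coeff R i) (op_power D L i))"

definition op_apply :: "('a::field \<Rightarrow> 'a) \<Rightarrow> 'a poly \<Rightarrow> 'a \<Rightarrow> 'a" where
  "op_apply D P y = (\<Sum>i\<le>degree P. coeff P i * (D ^^ i) y)"

definition centralizer :: "('a::field \<Rightarrow> 'a) \<Rightarrow> 'a poly \<Rightarrow> 'a poly set" where
  "centralizer D L = {P. op_mult D L P = op_mult D P L}"

text \<open>\<open>op_algebra D S\<close> is the algebra $C[S]$ of operators generated by \<open>S\<close> over the constants.\<close>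

inductive_set op_algebra :: "('a::field \<Rightarrow> 'a) \<Rightarrow> 'a poly set \<Rightarrow> 'a poly set"
  for D :: "'a::field \<Rightarrow> 'a" and S :: "'a poly set" where
  const: "c \<in> constants D \<Longrightarrow> [:c:] \<in> op_algebra D S"
| gen: "P \<in> S \<Longrightarrow> P \<in> op_algebra D S"
| add: "P \<in> op_algebra D S \<Longrightarrow> Q \<in> op_algebra D S \<Longrightarrow> P + Q \<in> op_algebra D S"
| mult: "P \<in> op_algebra D S \<Longrightarrow> Q \<in> op_algebra D S \<Longrightarrow> op_mult D P Q \<in> op_algebra D S"

definition right_divides ::
    "('a::field \<Rightarrow> 'a) \<Rightarrow> 'a set \<Rightarrow> 'a poly \<Rightarrow> 'a poly \<Rightarrow> bool" where
  "right_divides D F G P \<longleftrightarrow> (\<exists>Q\<in>polys_over F. P = op_mult D Q G)"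

definition is_gcrd ::
    "('a::field \<Rightarrow> 'a) \<Rightarrow> 'a set \<Rightarrow> 'a poly \<Rightarrow> 'a poly \<Rightarrow> 'a poly \<Rightarrow> bool" where
  "is_gcrd D F G P Q \<longleftrightarrow>
     G \<in> polys_over F \<and> lead_coeff G = 1 \<and> right_divides D F G P \<and> right_divides D F G Q \<and>
     (\<forall>H\<in>polys_over F. right_divides D F H P \<and> right_divides D F H Q \<longrightarrow> right_divides D F H G)"

definition algebro_geometric :: "('a::field \<Rightarrow> 'a) \<Rightarrow> 'a poly \<Rightarrow> bool" where
  "algebro_geometric D L \<longleftrightarrow> L \<notin> polys_over (constants D) \<and>
     (\<exists>P. coprime (degree P) (degree L) \<and> P \<in> centralizer D L)"

definition schroedinger :: "'a::field \<Rightarrow> 'a poly" where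
  "schroedinger u = [:u, 0, -1:]"

text \<open>\<open>A\<close> is the partner of \<open>L\<close>, \<open>s\<close> is the level and $A^2 + R(L) = 0$.\<close>

definition is_partner ::
    "('a::field \<Rightarrow> 'a) \<Rightarrow> 'a poly \<Rightarrow> nat \<Rightarrow> 'a poly \<Rightarrow> 'a poly \<Rightarrow> bool" where
  "is_partner D L s A R \<longleftrightarrow>
     lead_coeff A = 1 \<and> degree A = 2 * s + 1 \<and>
     A \<in> centralizer D L - op_algebra D {L} \<and>
     (\<forall>B \<in> centralizer D L - op_algebra D {L}. degree A \<le> degree B) \<and>
     centralizer D L = op_algebra D {L, A} \<and>
     R \<in> polys_over (constants D) \<and> degree R = 2 * s + 1 \<and>
     op_power D A 2 + op_subst D R L = 0"

definition spectral_curve :: "('a::field \<Rightarrow> 'a) \<Rightarrow> 'a poly \<Rightarrow> ('a \<times> 'a) set" where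
  "spectral_curve D R =
     {(l, m). l \<in> constants D \<and> m \<in> constants D \<and> m ^ 2 + poly R l = 0}"

definition spectral_zeros :: "('a::field \<Rightarrow> 'a) \<Rightarrow> 'a poly \<Rightarrow> ('a \<times> 'a) set" where
  "spectral_zeros D R = spectral_curve D R \<inter> (constants D \<times> {0})"

text \<open>Polynomials over \<open>'b\<close> in indeterminates indexed by \<open>'v\<close> are finitely supported functions from
  monomials to \<open>'b\<close>. A differential polynomial in one differential indeterminate has \<open>'v = nat\<close>
  (the index is the number of derivatives); in several, \<open>'v = nat \<times> nat\<close>, with \<open>(j, k)\<close> standing
  for the \<open>k\<close>-th derivative of the \<open>j\<close>-th indeterminate.\<close>

type_synonym ('v, 'b) mpol = "('v \<Rightarrow>\<^sub>0 nat) \<Rightarrow>\<^sub>0 'b"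

definition mpol_vars :: "('v, 'b::field) mpol \<Rightarrow> 'v set" where
  "mpol_vars p = (\<Union>m\<in>Poly_Mapping.keys p. Poly_Mapping.keys m)"

definition mpol_eval :: "('v \<Rightarrow> 'b::field) \<Rightarrow> ('v, 'b) mpol \<Rightarrow> 'b" where
  "mpol_eval e p = (\<Sum>m\<in>Poly_Mapping.keys p. Poly_Mapping.lookup p m *
     (\<Prod>v\<in>Poly_Mapping.keys m. e v ^ Poly_Mapping.lookup m v))"

definition dpol_eval1 :: "('b::field \<Rightarrow> 'b) \<Rightarrow> (nat, 'b) mpol \<Rightarrow> 'b \<Rightarrow> 'b" where
  "dpol_eval1 D f a = mpol_eval (\<lambda>k. (D ^^ k) a) f"

definition dpol_eval :: "('b::field \<Rightarrow> 'b) \<Rightarrow> (nat \<times> nat, 'b) mpol \<Rightarrow> (nat \<Rightarrow> 'b) \<Rightarrow> 'b" where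
  "dpol_eval D f a = mpol_eval (\<lambda>(j, k). (D ^^ k) (a j)) f"

definition dpols :: "'b::field set \<Rightarrow> nat \<Rightarrow> (nat \<times> nat, 'b) mpol set" where
  "dpols F n = {f. (\<forall>m. Poly_Mapping.lookup f m \<in> F) \<and> mpol_vars f \<subseteq> {..<n} \<times> UNIV}"

text \<open>Blum's axioms: if \<open>g \<noteq> 0\<close> and \<open>f\<close> has larger order than \<open>g\<close>, then \<open>f = 0, g \<noteq> 0\<close> has a
  solution. Elements of the field, as differential polynomials, have order \<open>-1\<close>.\<close>

definition diff_closed :: "('b::field \<Rightarrow> 'b) \<Rightarrow> bool" where
  "diff_closed D \<longleftrightarrow>
     (\<forall>f g :: (nat, 'b) mpol. g \<noteq> 0 \<and> (\<exists>n\<in>mpol_vars f. \<forall>k\<in>mpol_vars g. k < n) \<longrightarrow>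
        (\<exists>a. dpol_eval1 D f a = 0 \<and> dpol_eval1 D g a \<noteq> 0))"

text \<open>The \<open>n\<close>-tuple \<open>b\<close> is a specialization of \<open>a\<close> over \<open>F\<close> if every differential polynomial over \<open>F\<close>
  vanishing at \<open>a\<close> vanishes at \<open>b\<close>; it is generic if the converse holds as well. Following
  Kolchin, \<open>a\<close> is constrained over \<open>F\<close> if some differential polynomial over \<open>F\<close>
  vanishes at all non-generic specializations of \<open>a\<close> but not at \<open>a\<close>. Over a differentially
  closed field it makes no difference whether specializations are taken there or in
  larger differential fields.\<close>

definition specialization ::
    "('b::field \<Rightarrow> 'b) \<Rightarrow> 'b set \<Rightarrow> nat \<Rightarrow> (nat \<Rightarrow> 'b) \<Rightarrow> (nat \<Rightarrow> 'b) \<Rightarrow> bool" where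
  "specialization D F n a b \<longleftrightarrow>
     (\<forall>f\<in>dpols F n. dpol_eval D f a = 0 \<longrightarrow> dpol_eval D f b = 0)"

definition constrained :: "('b::field \<Rightarrow> 'b) \<Rightarrow> 'b set \<Rightarrow> nat \<Rightarrow> (nat \<Rightarrow> 'b) \<Rightarrow> bool" where
  "constrained D F n a \<longleftrightarrow>
     (\<exists>g\<in>dpols F n. dpol_eval D g a \<noteq> 0 \<and>
       (\<forall>b. specialization D F n a b \<and> \<not> specialization D F n b a \<longrightarrow> dpol_eval D g b = 0))"

text \<open>The differential field \<open>UNIV\<close> is differentially closed and all its finite families are
  constrained over \<open>F\<close>. A differential closure of \<open>F\<close> in the sense of a prime extension
  (one that embeds over \<open>F\<close> into every differentially closed extension of \<open>F\<close>) has these two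
  properties.\<close>

definition differential_closure :: "('b::field \<Rightarrow> 'b) \<Rightarrow> 'b set \<Rightarrow> bool" where
  "differential_closure D F \<longleftrightarrow>
     diff_subfield D F \<and> diff_closed D \<and> (\<forall>n a. constrained D F n a)"

text \<open>A fundamental set of solutions has as many elements as the order of the operator, and is
  linearly independent over the constants of the field \<open>E\<close>.\<close>

definition fundamental_set ::
    "('b::field \<Rightarrow> 'b) \<Rightarrow> 'b set \<Rightarrow> 'b poly \<Rightarrow> 'b list \<Rightarrow> bool" where
  "fundamental_set D E P ys \<longleftrightarrow>
     length ys = degree P \<and> set ys \<subseteq> E \<and> (\<forall>y\<in>set ys. op_apply D P y = 0) \<and>
     (\<forall>c. (\<forall>i<length ys. c i \<in> constants_in D E) \<and> (\<Sum>i<length ys. c i * ys ! i) = 0 \<longrightarrow>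
        (\<forall>i<length ys. c i = 0))"

definition picard_vessiot ::
    "('b::field \<Rightarrow> 'b) \<Rightarrow> 'b set \<Rightarrow> 'b poly \<Rightarrow> 'b set \<Rightarrow> bool" where
  "picard_vessiot D F P E \<longleftrightarrow>
     (\<exists>ys. fundamental_set D E P ys \<and> E = diff_adjoin D F (set ys)) \<and>
     constants_in D E = constants_in D F"

end

theory Submission
  imports Defs
begin

text \<open>Write \<open>F\<close> for the image of \<open>K\<close> in the differential closure and identify \<open>\<phi>\<^sub>0\<close>, \<open>u\<close>, \<open>l\<^sub>0\<close>
  with their images.

  Everything about constants follows from the fact that a differential closure of \<open>F\<close> acquires
  no new constants when the constants \<open>C\<close> of \<open>F\<close> are algebraically closed
  (\<open>constants_differential_closure\<close>); an intermediate field then has none either. On a constant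
  \<open>c\<close> a differential polynomial over \<open>F\<close> is an ordinary polynomial evaluated at \<open>c\<close>. If \<open>c\<close> were
  transcendental over \<open>F\<close>, every integer would be a non-generic specialization of \<open>c\<close>, and
  the polynomial that witnesses that \<open>c\<close> is constrained would have infinitely many roots. So
  \<open>c\<close> is algebraic over \<open>F\<close>; its minimal polynomial has constant coefficients, because
  differentiating the coefficients yields another polynomial vanishing at \<open>c\<close>, and hence \<open>c\<close>
  lies in \<open>C\<close>.

  The two extension steps are Liouvillian because \<open>y\<^sub>0' / y\<^sub>0 = \<phi>\<^sub>0\<close> lies in \<open>F\<close>, and because
  variation of constants turns \<open>y\<^sub>1\<close> into the primitive \<open>t = y\<^sub>1 / y\<^sub>0\<close> with \<open>t' = 1 / y\<^sub>0\<^sup>2\<close>.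
  That \<open>\<partial> - \<phi>\<^sub>0\<close> divides \<open>L - l\<^sub>0\<close> on the right amounts to the Riccati equation
  \<open>\<phi>\<^sub>0' + \<phi>\<^sub>0\<^sup>2 = u - l\<^sub>0\<close>, by which \<open>y\<^sub>0\<close> and \<open>y\<^sub>1\<close> are solutions of \<open>(L - l\<^sub>0) y = 0\<close>. They are
  independent over the constants since \<open>t' \<noteq> 0\<close>.\<close>

section \<open>Derivations and subfields\<close>

lemma derivation_add: "derivation D \<Longrightarrow> D (x + y) = D x + D y"
  and derivation_mult: "derivation D \<Longrightarrow> D (x * y) = D x * y + x * D y"
  by (simp_all add: derivation_def)

lemma derivation_0: "derivation D \<Longrightarrow> D 0 = 0"
  using derivation_add[of D 0 0] by (metis add.right_neutral add_left_imp_eq)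

lemma derivation_1: "derivation D \<Longrightarrow> D 1 = 0"
  using derivation_mult[of D 1 1] by (metis add.right_neutral add_left_imp_eq mult.left_neutral mult.right_neutral)

lemma derivation_minus: "derivation D \<Longrightarrow> D (- x) = - D x"
  using derivation_add[of D x "- x"] derivation_0[of D] by (simp add: eq_neg_iff_add_eq_0 add.commute)

lemma derivation_of_nat: "derivation D \<Longrightarrow> D (of_nat k) = 0"
  by (induction k) (simp_all add: derivation_0 derivation_1 derivation_add)

lemma derivation_inverse:
  assumes "derivation D" "x \<noteq> 0"
  shows "D (inverse x) = - (D x * inverse x * inverse x)"
proof -
  have "D x * inverse x + x * D (inverse x) = 0"
    using derivation_mult[OF assms(1), of x "inverse x"] derivation_1[OF assms(1)] assms(2) by simp
  hence "inverse x * (x * D (inverse x)) = inverse x * - (D x * inverse x)"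
    by (metis add_eq_0_iff)
  thus ?thesis using assms(2) by (simp add: field_simps)
qed

lemma subfieldD:
  assumes "is_subfield F"
  shows "0 \<in> F" "1 \<in> F" "x \<in> F \<Longrightarrow> y \<in> F \<Longrightarrow> x + y \<in> F" "x \<in> F \<Longrightarrow> y \<in> F \<Longrightarrow> x * y \<in> F"
    "x \<in> F \<Longrightarrow> - x \<in> F" "x \<in> F \<Longrightarrow> inverse x \<in> F"
  using assms by (auto simp: is_subfield_def)

lemma subfield_of_nat: "is_subfield F \<Longrightarrow> of_nat k \<in> F"
  by (induction k) (auto simp: subfieldD)

lemma subfield_sum: "is_subfield F \<Longrightarrow> (\<And>x. x \<in> S \<Longrightarrow> f x \<in> F) \<Longrightarrow> sum f S \<in> F"
  by (induction S rule: infinite_finite_induct) (auto simp: subfieldD)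

lemma is_subfield_Inter: "(\<And>E. E \<in> \<A> \<Longrightarrow> is_subfield E) \<Longrightarrow> is_subfield (\<Inter>\<A>)"
  unfolding is_subfield_def by blast

lemma is_subfield_field_adjoin: "is_subfield (field_adjoin F S)"
  unfolding field_adjoin_def by (rule is_subfield_Inter) auto

lemma field_adjoin_superset: "F \<subseteq> field_adjoin F S" "S \<subseteq> field_adjoin F S"
  unfolding field_adjoin_def by blast+

lemma field_adjoin_least: "is_subfield E \<Longrightarrow> F \<subseteq> E \<Longrightarrow> S \<subseteq> E \<Longrightarrow> field_adjoin F S \<subseteq> E"
  unfolding field_adjoin_def by blast

lemma diff_subfield_diff_adjoin: "diff_subfield D (diff_adjoin D F S)"
  unfolding diff_subfield_def
proof (intro conjI ballI)
  show "is_subfield (diff_adjoin D F S)"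
    unfolding diff_adjoin_def by (rule is_subfield_Inter) (auto simp: diff_subfield_def)
  show "D x \<in> diff_adjoin D F S" if "x \<in> diff_adjoin D F S" for x
    using that unfolding diff_adjoin_def diff_subfield_def by blast
qed

lemma diff_adjoin_superset: "F \<subseteq> diff_adjoin D F S" "S \<subseteq> diff_adjoin D F S"
  unfolding diff_adjoin_def by blast+

lemma diff_adjoin_least: "diff_subfield D E \<Longrightarrow> F \<subseteq> E \<Longrightarrow> S \<subseteq> E \<Longrightarrow> diff_adjoin D F S \<subseteq> E"
  unfolding diff_adjoin_def by blast

lemma diff_adjoin_mono: "S \<subseteq> T \<Longrightarrow> diff_adjoin D F S \<subseteq> diff_adjoin D F T"
  unfolding diff_adjoin_def by blast

text \<open>The elements of \<open>F(S)\<close> whose derivative stays in \<open>F(S)\<close> form a subfield, so closure under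
  the derivation can be tested on generators.\<close>

lemma diff_adjoin_eq_field_adjoin:
  assumes D: "derivation D" and F: "diff_subfield D F"
    and S: "\<And>x. x \<in> S \<Longrightarrow> D x \<in> field_adjoin F S"
  shows "diff_adjoin D F S = field_adjoin F S"
proof
  let ?E = "field_adjoin F S"
  note E = subfieldD[OF is_subfield_field_adjoin[of F S]]
  have inv: "D (inverse x) \<in> ?E" if "x \<in> ?E" "D x \<in> ?E" for x
    using that derivation_inverse[OF D, of x] E derivation_0[OF D] by (cases "x = 0") auto
  have "is_subfield {x \<in> ?E. D x \<in> ?E}"
    unfolding is_subfield_def
    using E inv by (auto simp: derivation_0[OF D] derivation_1[OF D] derivation_add[OF D]
        derivation_mult[OF D] derivation_minus[OF D])
  hence "?E \<subseteq> {x \<in> ?E. D x \<in> ?E}"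
    using F S field_adjoin_superset[of F S] field_adjoin_superset(2)[of S F]
    by (intro field_adjoin_least) (auto simp: diff_subfield_def)
  hence "diff_subfield D ?E"
    by (auto simp: diff_subfield_def is_subfield_field_adjoin)
  thus "diff_adjoin D F S \<subseteq> ?E"
    by (rule diff_adjoin_least) (rule field_adjoin_superset)+
  show "?E \<subseteq> diff_adjoin D F S"
    using diff_subfield_diff_adjoin[of D F S] diff_adjoin_superset[where D = D]
    by (intro field_adjoin_least) (auto simp: diff_subfield_def)
qed

section \<open>Polynomials over a subfield\<close>

lemma polys_over_add: "is_subfield F \<Longrightarrow> p \<in> polys_over F \<Longrightarrow> q \<in> polys_over F \<Longrightarrow> p + q \<in> polys_over F"
  by (simp add: polys_over_def subfieldD)

lemma polys_over_smult: "is_subfield F \<Longrightarrow> a \<in> F \<Longrightarrow> p \<in> polys_over F \<Longrightarrow> smult a p \<in> polys_over F"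
  by (simp add: polys_over_def subfieldD)

lemma polys_over_mult: "is_subfield F \<Longrightarrow> p \<in> polys_over F \<Longrightarrow> q \<in> polys_over F \<Longrightarrow> p * q \<in> polys_over F"
  by (auto simp: polys_over_def coeff_mult intro!: subfield_sum subfieldD(4))

lemma polys_over_pCons_iff: "pCons a p \<in> polys_over F \<longleftrightarrow> a \<in> F \<and> p \<in> polys_over F"
proof
  assume "pCons a p \<in> polys_over F"
  hence *: "coeff (pCons a p) i \<in> F" for i by (simp add: polys_over_def)
  show "a \<in> F \<and> p \<in> polys_over F"
    using *[of 0] *[of "Suc _"] by (simp add: polys_over_def)
qed (auto simp: polys_over_def coeff_pCons split: nat.split)

lemma polys_over_0: "is_subfield F \<Longrightarrow> 0 \<in> polys_over F"
  by (simp add: polys_over_def subfieldD)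

lemma polys_over_1: "is_subfield F \<Longrightarrow> 1 \<in> polys_over F"
  by (simp add: polys_over_0 polys_over_pCons_iff one_pCons subfieldD)

lemma polys_over_sum: "is_subfield F \<Longrightarrow> (\<And>x. x \<in> S \<Longrightarrow> f x \<in> polys_over F) \<Longrightarrow> sum f S \<in> polys_over F"
  by (induction S rule: infinite_finite_induct) (auto simp: polys_over_0 polys_over_add)

lemma polys_over_prod: "is_subfield F \<Longrightarrow> (\<And>x. x \<in> S \<Longrightarrow> f x \<in> polys_over F) \<Longrightarrow> prod f S \<in> polys_over F"
  by (induction S rule: infinite_finite_induct) (auto simp: polys_over_1 polys_over_mult)

lemma polys_over_power: "is_subfield F \<Longrightarrow> p \<in> polys_over F \<Longrightarrow> p ^ n \<in> polys_over F"
  by (induction n) (auto simp: polys_over_1 polys_over_mult)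

lemma poly_in_subfield: "is_subfield F \<Longrightarrow> p \<in> polys_over F \<Longrightarrow> x \<in> F \<Longrightarrow> poly p x \<in> F"
  by (induction p) (auto simp: subfieldD polys_over_pCons_iff)

lemma synthetic_div_in_polys_over:
  "is_subfield F \<Longrightarrow> p \<in> polys_over F \<Longrightarrow> x \<in> F \<Longrightarrow> synthetic_div p x \<in> polys_over F"
  by (induction p) (auto simp: polys_over_0 polys_over_pCons_iff poly_in_subfield)

lemma poly_map_derivation:
  assumes "derivation D" "D c = 0"
  shows "poly (map_poly D p) c = D (poly p c)"
  using assms
  by (induction p) (auto simp: map_poly_pCons derivation_0 derivation_add derivation_mult)

section \<open>Constants of a differential closure\<close>

text \<open>Applying the derivation to the coefficients of the monic minimal polynomial of a constant lowers
  the degree and keeps the root, so the result is \<open>0\<close>: the coefficients are constants. A root of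
  this polynomial among the constants splits off a linear factor, and by minimality that factor is
  the whole polynomial.\<close>

lemma algebraic_constant_in_base:
  assumes D: "derivation D" and F: "diff_subfield D F"
    and closed: "alg_closed_set (constants_in D F)"
    and alg: "algebraic_over F c" and c: "D c = 0"
  shows "c \<in> constants_in D F"
proof -
  have sub: "is_subfield F" using F by (simp add: diff_subfield_def)
  let ?P = "\<lambda>p. p \<in> polys_over F \<and> p \<noteq> 0 \<and> poly p c = 0"
  obtain q where "?P q" using alg by (auto simp: algebraic_over_def)
  from ex_has_least_nat[of ?P, OF this, of degree]
  obtain p where p: "?P p" and least: "\<And>q. ?P q \<Longrightarrow> degree p \<le> degree q" by blast
  define m where "m = smult (inverse (lead_coeff p)) p"
  have deg_m: "degree m = degree p" using p by (simp add: m_def)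
  have monic: "coeff m (degree p) = 1" using p by (simp add: m_def)
  have "inverse (lead_coeff p) \<in> F" using p subfieldD[OF sub] by (simp add: polys_over_def)
  hence m: "?P m" using p sub by (auto simp: m_def polys_over_smult)
  have "map_poly D m = 0"
  proof (rule ccontr)
    assume nz: "map_poly D m \<noteq> 0"
    have "map_poly D m \<in> polys_over F"
      using m F by (auto simp: polys_over_def coeff_map_poly derivation_0[OF D] diff_subfield_def)
    moreover have "poly (map_poly D m) c = 0"
      using m by (simp add: poly_map_derivation[OF D c] derivation_0[OF D])
    ultimately have "degree p \<le> degree (map_poly D m)" using nz least by blast
    moreover have "degree (map_poly D m) \<le> degree p" using map_poly_degree_leq[of D m] deg_m by simp
    ultimately have "lead_coeff (map_poly D m) = D (coeff m (degree p))"
      by (simp add: coeff_map_poly derivation_0[OF D])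
    thus False using nz by (simp add: monic derivation_1[OF D])
  qed
  hence "D (coeff m i) = 0" for i
    using coeff_map_poly[of D m i] derivation_0[OF D] by simp
  hence "m \<in> polys_over (constants_in D F)"
    using m by (auto simp: polys_over_def constants_in_def)
  moreover have "degree m > 0"
  proof (rule ccontr)
    assume "\<not> degree m > 0"
    then obtain a where "m = [:a:]" by (meson degree_eq_zeroE not_gr_zero)
    thus False using m by auto
  qed
  ultimately obtain x where x: "x \<in> constants_in D F" "poly m x = 0"
    using closed by (auto simp: alg_closed_set_def)
  let ?q = "synthetic_div m x"
  have fact: "m = [:- x, 1:] * ?q" using synthetic_div_correct'[of x m] x(2) by simp
  have "?q \<noteq> 0" using fact m by (metis mult_zero_right)
  moreover have "?q \<in> polys_over F"
    using m x(1) sub by (auto simp: constants_in_def intro: synthetic_div_in_polys_over)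
  moreover have "degree ?q < degree p"
    using deg_m \<open>degree m > 0\<close> by (simp add: degree_synthetic_div)
  ultimately have "poly ?q c \<noteq> 0" using least[of ?q] by auto
  moreover have "poly m c = (c - x) * poly ?q c"
    using arg_cong[OF fact, of "\<lambda>p. poly p c"] by (simp add: algebra_simps)
  ultimately have "c = x" using m by simp
  thus ?thesis using x(1) by simp
qed

text \<open>The ordinary polynomial obtained from a differential polynomial by setting all proper
  derivatives to \<open>0\<close> and identifying the indeterminates.\<close>

definition constant_poly :: "(nat \<times> nat, 'b::field) mpol \<Rightarrow> 'b poly" where
  "constant_poly f = (\<Sum>m\<in>Poly_Mapping.keys f. smult (Poly_Mapping.lookup f m)
     (\<Prod>v\<in>Poly_Mapping.keys m. (if snd v = 0 then [:0, 1:] else 0) ^ Poly_Mapping.lookup m v))"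

lemma dpol_eval_constant:
  assumes "derivation D" "D c = 0"
  shows "dpol_eval D f (\<lambda>_. c) = poly (constant_poly f) c"
proof -
  have "(D ^^ k) c = (if k = 0 then c else 0)" for k
    by (induction k) (auto simp: assms(2) derivation_0[OF assms(1)])
  hence "(case v of (j, k) \<Rightarrow> (D ^^ k) c) = poly (if snd v = 0 then [:0, 1:] else 0) c" for v :: "nat \<times> nat"
    by (auto split: prod.split)
  thus ?thesis
    by (simp add: dpol_eval_def mpol_eval_def constant_poly_def poly_sum poly_prod)
qed

lemma constant_poly_in_polys_over:
  assumes "is_subfield F" "f \<in> dpols F n"
  shows "constant_poly f \<in> polys_over F"
  unfolding constant_poly_def using assms
  by (intro polys_over_sum polys_over_smult polys_over_prod polys_over_power)
     (auto simp: dpols_def polys_over_pCons_iff polys_over_0 subfieldD)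

text \<open>A nonzero \<open>a\<close> puts the constant monomial into the support, which makes the evaluation
  uniform; the points \<open>- a\<close> needed below are positive integers.\<close>

lemma linear_dpol:
  fixes a :: "'b::field"
  assumes "is_subfield F" "a \<in> F" "a \<noteq> 0"
  obtains f where "f \<in> dpols F 1" "\<And>D b. dpol_eval D f b = a + b 0"
proof -
  let ?X = "Poly_Mapping.single (0, 0) 1 :: nat \<times> nat \<Rightarrow>\<^sub>0 nat"
  define f :: "(nat \<times> nat, 'b) mpol" where
    "f = Poly_Mapping.single ?X 1 + Poly_Mapping.single 0 a"
  have X: "?X \<noteq> 0" by (metis lookup_single_eq lookup_zero zero_neq_one)
  have lookup: "Poly_Mapping.lookup f m = (if m = ?X then 1 else if m = 0 then a else 0)" for m
    using X by (auto simp: f_def lookup_add lookup_single when_def)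
  have keys: "Poly_Mapping.keys f = {?X, 0}"
    using assms(3) by (auto simp: in_keys_iff lookup split: if_splits)
  have "f \<in> dpols F 1"
    using assms by (auto simp: dpols_def lookup mpol_vars_def keys subfieldD)
  moreover have "dpol_eval D f b = a + b 0" for D b
    using X by (simp add: dpol_eval_def mpol_eval_def keys lookup)
  ultimately show ?thesis using that by blast
qed

text \<open>If \<open>c\<close> is transcendental, an ordinary polynomial over \<open>F\<close> that vanishes at \<open>c\<close> is \<open>0\<close>, so
  every constant specializes \<open>c\<close>; constants from \<open>F\<close> do so non-generically. A differential
  polynomial that separates \<open>c\<close> from its non-generic specializations would vanish at every
  positive integer.\<close>

lemma constrained_constant_algebraic:
  fixes D :: "'b::field_char_0 \<Rightarrow> 'b"
  assumes D: "derivation D" and F: "is_subfield F"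
    and con: "constrained D F 1 (\<lambda>_. c)" and c: "D c = 0"
  shows "algebraic_over F c"
proof (rule ccontr)
  assume trans: "\<not> algebraic_over F c"
  obtain g where g: "g \<in> dpols F 1" "dpol_eval D g (\<lambda>_. c) \<noteq> 0"
    and van: "\<And>b. specialization D F 1 (\<lambda>_. c) b \<Longrightarrow> \<not> specialization D F 1 b (\<lambda>_. c) \<Longrightarrow>
      dpol_eval D g b = 0"
    using con unfolding constrained_def by blast
  have root: "poly (constant_poly g) (of_nat (Suc k)) = 0" for k
  proof -
    let ?b = "of_nat (Suc k) :: 'b"
    have Db: "D ?b = 0" by (rule derivation_of_nat[OF D])
    have bF: "?b \<in> F" by (rule subfield_of_nat[OF F])
    have "specialization D F 1 (\<lambda>_. c) (\<lambda>_. ?b)"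
      unfolding specialization_def
    proof (intro ballI impI)
      fix f assume f: "f \<in> dpols F 1" "dpol_eval D f (\<lambda>_. c) = 0"
      hence "constant_poly f = 0"
        using trans constant_poly_in_polys_over[OF F f(1)]
        by (auto simp: algebraic_over_def dpol_eval_constant[OF D c])
      thus "dpol_eval D f (\<lambda>_. ?b) = 0" by (simp only: dpol_eval_constant[OF D Db] poly_0)
    qed
    moreover have "\<not> specialization D F 1 (\<lambda>_. ?b) (\<lambda>_. c)"
    proof
      assume spec: "specialization D F 1 (\<lambda>_. ?b) (\<lambda>_. c)"
      have "- ?b \<noteq> 0" by (simp only: neg_equal_0_iff_equal of_nat_eq_0_iff nat.distinct not_False_eq_True)
      then obtain f where f: "f \<in> dpols F 1" "\<And>D b. dpol_eval D f b = - ?b + b 0"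
        using linear_dpol[OF F subfieldD(5)[OF F bF]] by blast
      have "- ?b + c = 0"
        using spec[unfolded specialization_def, rule_format, OF f(1)] unfolding f(2)
        by (metis add.left_inverse)
      hence "poly [:- ?b, 1:] c = 0" by simp
      moreover have "[:- ?b, 1:] \<in> polys_over F"
        using subfieldD[OF F] bF polys_over_0[OF F] by (auto simp only: polys_over_pCons_iff)
      ultimately show False using trans unfolding algebraic_over_def
        by (metis one_neq_zero pCons_eq_0_iff)
    qed
    ultimately have "dpol_eval D g (\<lambda>_. ?b) = 0" by (rule van)
    thus ?thesis by (simp only: dpol_eval_constant[OF D Db])
  qed
  have "infinite (range (\<lambda>k. of_nat (Suc k) :: 'b))"
    by (rule range_inj_infinite) (auto simp: inj_on_def simp del: of_nat_Suc)
  moreover have "range (\<lambda>k. of_nat (Suc k)) \<subseteq> {x. poly (constant_poly g) x = 0}"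
    using root by auto
  ultimately have "constant_poly g = 0"
    using poly_roots_finite finite_subset by blast
  thus False using g(2) by (simp add: dpol_eval_constant[OF D c])
qed

lemma constants_differential_closure:
  fixes D :: "'b::field_char_0 \<Rightarrow> 'b"
  assumes D: "derivation D" and cl: "differential_closure D F"
    and closed: "alg_closed_set (constants_in D F)"
  shows "constants D = constants_in D F"
proof -
  have F: "diff_subfield D F" and con: "\<And>n a. constrained D F n a"
    using cl by (auto simp: differential_closure_def)
  have "c \<in> constants_in D F" if "D c = 0" for c
    using F con that closed
    by (intro algebraic_constant_in_base[OF D] constrained_constant_algebraic[OF D])
       (auto simp: diff_subfield_def)
  thus ?thesis by (auto simp: constants_in_def)
qed

section \<open>Differential embeddings\<close>

lemma diff_embeddingD:
  assumes "diff_embedding D D' K \<iota>"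
  shows "\<iota> 1 = 1" "x \<in> K \<Longrightarrow> y \<in> K \<Longrightarrow> \<iota> (x + y) = \<iota> x + \<iota> y"
    "x \<in> K \<Longrightarrow> y \<in> K \<Longrightarrow> \<iota> (x * y) = \<iota> x * \<iota> y" "x \<in> K \<Longrightarrow> \<iota> (D x) = D' (\<iota> x)"
  using assms by (auto simp: diff_embedding_def)

text \<open>Values of \<open>\<iota>\<close> outside \<open>K\<close> are arbitrary, so the homomorphism laws are derived on \<open>K\<close> only.\<close>

lemma diff_embedding_0: "diff_embedding D D' K \<iota> \<Longrightarrow> is_subfield K \<Longrightarrow> \<iota> 0 = 0"
  using diff_embeddingD(2)[of D D' K \<iota> 0 0] subfieldD(1)[of K]
  by (metis add.right_neutral add_left_imp_eq)

lemma diff_embedding_minus: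
  "diff_embedding D D' K \<iota> \<Longrightarrow> is_subfield K \<Longrightarrow> x \<in> K \<Longrightarrow> \<iota> (- x) = - \<iota> x"
  using diff_embeddingD(2)[of D D' K \<iota> x "- x"]
  by (simp add: subfieldD diff_embedding_0 eq_neg_iff_add_eq_0 add.commute)

lemma diff_embedding_eq_0_iff:
  assumes "diff_embedding D D' K \<iota>" "is_subfield K" "x \<in> K"
  shows "\<iota> x = 0 \<longleftrightarrow> x = 0"
proof
  assume "\<iota> x = 0"
  show "x = 0"
  proof (rule ccontr)
    assume "x \<noteq> 0"
    hence "\<iota> x * \<iota> (inverse x) = 1"
      using diff_embeddingD(1)[OF assms(1)] diff_embeddingD(3)[OF assms(1,3), of "inverse x"] assms
      by (simp add: subfieldD)
    thus False using \<open>\<iota> x = 0\<close> by simp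
  qed
qed (use diff_embedding_0[OF assms(1,2)] in simp)

lemma constants_in_image:
  assumes "diff_embedding D D' K \<iota>" "diff_subfield D K"
  shows "constants_in D' (\<iota> ` K) = \<iota> ` constants_in D K"
proof -
  have "D' (\<iota> x) = 0 \<longleftrightarrow> D x = 0" if "x \<in> K" for x
    using that assms diff_embedding_eq_0_iff[OF assms(1), of "D x"] diff_embeddingD(4)[OF assms(1) that]
    by (simp add: diff_subfield_def)
  thus ?thesis by (auto simp: constants_in_def)
qed

lemma poly_map_diff_embedding:
  assumes emb: "diff_embedding D D' K \<iota>" and K: "is_subfield K" and "p \<in> polys_over K" "x \<in> K"
  shows "poly (map_poly \<iota> p) (\<iota> x) = \<iota> (poly p x)"
  using assms(3)
proof (induction p)
  case 0
  show ?case by (simp add: diff_embedding_0[OF emb K])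
next
  case (pCons a p)
  hence a: "a \<in> K" and p: "p \<in> polys_over K" by (auto simp: polys_over_pCons_iff)
  have "poly p x \<in> K" using K p assms(4) by (rule poly_in_subfield)
  hence "\<iota> (a + x * poly p x) = \<iota> a + \<iota> x * \<iota> (poly p x)"
    using a assms(4) K by (simp add: diff_embeddingD[OF emb] subfieldD)
  thus ?case using pCons.IH[OF p] by (simp add: map_poly_pCons diff_embedding_0[OF emb K])
qed

lemma alg_closed_set_image:
  assumes emb: "diff_embedding D D' K \<iota>" and K: "is_subfield K" and CK: "C \<subseteq> K"
    and 0: "0 \<in> C" and closed: "alg_closed_set C"
  shows "alg_closed_set (\<iota> ` C)"
  unfolding alg_closed_set_def
proof (intro ballI impI)
  fix p assume p: "p \<in> polys_over (\<iota> ` C)" "degree p > 0"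
  define j where "j = inv_into C \<iota>"
  have j: "j y \<in> C \<and> \<iota> (j y) = y" if "y \<in> \<iota> ` C" for y
    using that by (simp add: j_def inv_into_into f_inv_into_f)
  have "0 \<in> \<iota> ` C" using 0 diff_embedding_0[OF emb K] by (metis imageI)
  hence j0: "j 0 = 0" using j[of 0] CK diff_embedding_eq_0_iff[OF emb K, of "j 0"] by blast
  let ?q = "map_poly j p"
  have q: "?q \<in> polys_over C" using p(1) j by (auto simp: polys_over_def coeff_map_poly j0)
  have pq: "map_poly \<iota> ?q = p"
    using p(1) j
    by (intro poly_eqI) (simp add: coeff_map_poly j0 diff_embedding_0[OF emb K] polys_over_def)
  have "degree p \<le> degree ?q" using map_poly_degree_leq[of \<iota> ?q] by (simp only: pq)
  hence "degree ?q > 0" using p(2) by linarith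
  then obtain x where x: "x \<in> C" "poly ?q x = 0" using q closed by (auto simp: alg_closed_set_def)
  have "?q \<in> polys_over K" "x \<in> K" using q x CK by (auto simp: polys_over_def)
  from poly_map_diff_embedding[OF emb K this] have "poly p (\<iota> x) = 0"
    using x(2) by (simp add: pq diff_embedding_0[OF emb K])
  thus "\<exists>y\<in>\<iota> ` C. poly p y = 0" using x(1) by blast
qed

section \<open>The Riccati equation\<close>

text \<open>The remainder of \<open>\<Sum> p\<^sub>i \<partial>\<^sup>i\<close> under right division by \<open>\<partial> - \<phi>\<close>: modulo the left ideal
  generated by \<open>\<partial> - \<phi>\<close> one has \<open>\<partial> f = f \<partial> + f' \<equiv> f' + \<phi> f\<close>, so \<open>\<partial>\<^sup>i\<close> is congruent to the
  \<open>i\<close>-th iterate of \<open>f \<mapsto> f' + \<phi> f\<close> at \<open>1\<close>.\<close>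

definition right_remainder :: "('a::field \<Rightarrow> 'a) \<Rightarrow> 'a \<Rightarrow> 'a poly \<Rightarrow> 'a" where
  "right_remainder D \<phi> P = (\<Sum>i\<le>degree P. coeff P i * ((\<lambda>f. D f + \<phi> * f) ^^ i) 1)"

lemma right_remainder_bound:
  assumes "degree P \<le> n"
  shows "right_remainder D \<phi> P = (\<Sum>i\<le>n. coeff P i * ((\<lambda>f. D f + \<phi> * f) ^^ i) 1)"
  unfolding right_remainder_def
  using assms by (intro sum.mono_neutral_left) (auto simp: coeff_eq_0)

lemma right_remainder_add:
  "right_remainder D \<phi> (P + Q) = right_remainder D \<phi> P + right_remainder D \<phi> Q"
proof -
  define n where "n = max (degree P) (degree Q)"
  have "degree (P + Q) \<le> n" "degree P \<le> n" "degree Q \<le> n"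
    by (auto simp: n_def degree_add_le)
  thus ?thesis by (simp add: right_remainder_bound sum.distrib distrib_right)
qed

lemma right_remainder_smult: "right_remainder D \<phi> (smult a P) = a * right_remainder D \<phi> P"
  by (simp add: right_remainder_bound[OF degree_smult_le] right_remainder_def sum_distrib_left mult.assoc)

lemma right_remainder_sum:
  "right_remainder D \<phi> (sum f S) = (\<Sum>x\<in>S. right_remainder D \<phi> (f x))"
proof (induction S rule: infinite_finite_induct)
  case (insert x S)
  thus ?case by (simp add: right_remainder_add)
qed (simp_all add: right_remainder_def)

lemma derivation_sum: "derivation D \<Longrightarrow> D (sum f S) = (\<Sum>x\<in>S. D (f x))"
  by (induction S rule: infinite_finite_induct) (simp_all add: derivation_0 derivation_add)

lemma right_remainder_partial_times:
  assumes D: "derivation D"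
  shows "right_remainder D \<phi> (partial_times D Q) =
    D (right_remainder D \<phi> Q) + \<phi> * right_remainder D \<phi> Q"
proof -
  let ?r = "\<lambda>i. ((\<lambda>f. D f + \<phi> * f) ^^ i) 1"
  have "right_remainder D \<phi> (map_poly D Q) = (\<Sum>i\<le>degree Q. D (coeff Q i) * ?r i)"
    by (simp add: right_remainder_bound[OF map_poly_degree_leq] coeff_map_poly derivation_0[OF D])
  moreover have "right_remainder D \<phi> (pCons 0 Q) = (\<Sum>i\<le>degree Q. coeff Q i * ?r (Suc i))"
    by (simp add: right_remainder_bound[OF degree_pCons_le] sum.atMost_Suc_shift del: sum.atMost_Suc)
  ultimately have "right_remainder D \<phi> (partial_times D Q) =
      (\<Sum>i\<le>degree Q. D (coeff Q i) * ?r i + coeff Q i * ?r (Suc i))"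
    by (simp only: partial_times_def right_remainder_add sum.distrib)
  thus ?thesis
    by (simp add: right_remainder_def derivation_sum[OF D] derivation_mult[OF D] sum_distrib_left
        sum.distrib[symmetric] algebra_simps)
qed

text \<open>The kernel of the remainder is a left ideal. This is why a divisor \<open>\<partial> - \<phi>\<close> yields an
  equation for \<open>\<phi>\<close> without determining the quotient.\<close>

lemma right_remainder_op_mult:
  assumes D: "derivation D" and G: "right_remainder D \<phi> G = 0"
  shows "right_remainder D \<phi> (op_mult D Q G) = 0"
proof -
  have "right_remainder D \<phi> ((partial_times D ^^ i) G) = 0" for i
    by (induction i) (simp_all add: G right_remainder_partial_times[OF D] derivation_0[OF D])
  thus ?thesis by (simp add: op_mult_def right_remainder_sum right_remainder_smult)
qed

text \<open>The remainder of \<open>-\<partial>\<^sup>2 + v\<close> is \<open>v - (\<phi>' + \<phi>\<^sup>2)\<close>.\<close>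

lemma riccati_of_right_divides:
  assumes D: "derivation D" and div: "right_divides D F [:- \<phi>, 1:] [:v, 0, -1:]"
  shows "D \<phi> + \<phi> * \<phi> = v"
proof -
  have "right_remainder D \<phi> [:- \<phi>, 1:] = 0"
    by (simp add: right_remainder_def derivation_1[OF D])
  hence "right_remainder D \<phi> [:v, 0, -1:] = 0"
    using div right_remainder_op_mult[OF D] by (auto simp: right_divides_def)
  hence "v + (- D \<phi> - \<phi> * \<phi>) = 0"
    by (simp add: right_remainder_def derivation_1[OF D] numeral_2_eq_2)
  hence "v = - (- D \<phi> - \<phi> * \<phi>)" by (simp only: eq_neg_iff_add_eq_0)
  thus ?thesis by simp
qed

section \<open>The Picard-Vessiot extension\<close>

lemma liouvillian_extension_simple:
  assumes "is_subfield F" "liouvillian_element D F t"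
  shows "liouvillian_extension D F (field_adjoin F {t})"
proof -
  have "field_adjoin F {} = F"
    using field_adjoin_superset(1)[of F "{}"] field_adjoin_least[OF assms(1), of F "{}"] by blast
  thus ?thesis unfolding liouvillian_extension_def
    using assms(2) by (intro exI[of _ "[t]"]) simp
qed

lemma liouvillian_extension_hyperexponential:
  assumes D: "derivation D" and F: "diff_subfield D F"
    and "y \<noteq> 0" "\<phi> \<in> F" and y: "D y = \<phi> * y"
  shows "liouvillian_extension D F (diff_adjoin D F {y})"
proof -
  have "D y \<in> field_adjoin F {y}"
    unfolding y using assms(4) field_adjoin_superset[of F "{y}"] field_adjoin_superset(2)[of "{y}" F]
    by (intro subfieldD(4)[OF is_subfield_field_adjoin]) auto
  hence "diff_adjoin D F {y} = field_adjoin F {y}"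
    by (intro diff_adjoin_eq_field_adjoin[OF D F]) auto
  moreover have "liouvillian_element D F y"
    using assms by (simp add: liouvillian_element_def)
  ultimately show ?thesis
    using F liouvillian_extension_simple[of F D y] by (simp add: diff_subfield_def)
qed

text \<open>Variation of constants: the solutions of \<open>y' - \<phi> y = 1 / y\<^sub>0\<close> are the products of \<open>y\<^sub>0\<close> with
  the primitives of \<open>1 / y\<^sub>0\<^sup>2\<close>.\<close>

lemma derivation_quotient_solutions:
  assumes D: "derivation D" and "y\<^sub>0 \<noteq> 0"
    and y\<^sub>0: "D y\<^sub>0 = \<phi> * y\<^sub>0" and y\<^sub>1: "D y\<^sub>1 = \<phi> * y\<^sub>1 + inverse y\<^sub>0"
  shows "D (y\<^sub>1 * inverse y\<^sub>0) = inverse y\<^sub>0 * inverse y\<^sub>0"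
  using assms(2) by (simp add: derivation_mult[OF D] derivation_inverse[OF D] y\<^sub>0 y\<^sub>1 algebra_simps)

text \<open>As a generator over \<open>F\<langle>y\<^sub>0\<rangle>\<close>, the element \<open>y\<^sub>1\<close> can be exchanged for the primitive
  \<open>t = y\<^sub>1 / y\<^sub>0\<close>; \<open>y\<^sub>1\<close> itself is neither primitive nor hyperexponential in general.\<close>

lemma liouvillian_extension_second_solution:
  assumes D: "derivation D" and nz: "y\<^sub>0 \<noteq> 0"
    and y\<^sub>0: "D y\<^sub>0 = \<phi> * y\<^sub>0" and y\<^sub>1: "D y\<^sub>1 = \<phi> * y\<^sub>1 + inverse y\<^sub>0"
  shows "liouvillian_extension D (diff_adjoin D F {y\<^sub>0}) (diff_adjoin D F {y\<^sub>0, y\<^sub>1})"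
proof -
  let ?E = "diff_adjoin D F {y\<^sub>0}" and ?E' = "diff_adjoin D F {y\<^sub>0, y\<^sub>1}"
  define t where "t = y\<^sub>1 * inverse y\<^sub>0"
  have E: "diff_subfield D ?E" and E': "diff_subfield D ?E'" by (rule diff_subfield_diff_adjoin)+
  have y0E: "y\<^sub>0 \<in> ?E" using diff_adjoin_superset(2)[of "{y\<^sub>0}" D F] by simp
  have Dt: "D t \<in> ?E"
    unfolding t_def derivation_quotient_solutions[OF assms]
    using E y0E by (simp add: diff_subfield_def subfieldD)
  have eq: "diff_adjoin D ?E {t} = field_adjoin ?E {t}"
    using Dt field_adjoin_superset(1) by (intro diff_adjoin_eq_field_adjoin[OF D E]) blast
  have sub: "is_subfield (diff_adjoin D ?E {t})" and sub': "is_subfield ?E'"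
    using diff_subfield_diff_adjoin by (auto simp: diff_subfield_def)
  have "y\<^sub>0 \<in> diff_adjoin D ?E {t}" "t \<in> diff_adjoin D ?E {t}"
    using y0E diff_adjoin_superset[where D = D] by blast+
  hence "t * y\<^sub>0 \<in> diff_adjoin D ?E {t}" by (rule subfieldD(4)[OF sub, rotated])
  hence "y\<^sub>1 \<in> diff_adjoin D ?E {t}" using nz by (simp add: t_def mult.assoc)
  hence "?E' \<subseteq> diff_adjoin D ?E {t}"
    using \<open>y\<^sub>0 \<in> diff_adjoin D ?E {t}\<close> diff_adjoin_superset(1)[of F D "{y\<^sub>0}"]
      diff_adjoin_superset(1)[of ?E D "{t}"]
    by (intro diff_adjoin_least diff_subfield_diff_adjoin) auto
  moreover have "diff_adjoin D ?E {t} \<subseteq> ?E'"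
  proof (rule diff_adjoin_least[OF E'])
    show "?E \<subseteq> ?E'" by (rule diff_adjoin_mono) simp
    have "y\<^sub>0 \<in> ?E'" "y\<^sub>1 \<in> ?E'" using diff_adjoin_superset(2)[of "{y\<^sub>0, y\<^sub>1}" D F] by auto
    thus "{t} \<subseteq> ?E'" using subfieldD[OF sub'] by (simp add: t_def)
  qed
  ultimately have "?E' = field_adjoin ?E {t}" using eq by blast
  moreover have "liouvillian_element D ?E t" using Dt by (simp add: liouvillian_element_def)
  ultimately show ?thesis
    using E liouvillian_extension_simple[of ?E D t] by (simp add: diff_subfield_def)
qed

text \<open>By the Riccati equation \<open>-\<partial>\<^sup>2 + v = (-\<partial> - \<phi>) (\<partial> - \<phi>)\<close>. The right factor kills \<open>y\<^sub>0\<close> and sends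
  \<open>y\<^sub>1\<close> to \<open>1 / y\<^sub>0\<close>, which the left factor kills.\<close>

lemma fundamental_set_of_riccati:
  assumes D: "derivation D" and nz: "y\<^sub>0 \<noteq> 0"
    and y\<^sub>0: "D y\<^sub>0 = \<phi> * y\<^sub>0" and y\<^sub>1: "D y\<^sub>1 = \<phi> * y\<^sub>1 + inverse y\<^sub>0"
    and ric: "D \<phi> + \<phi> * \<phi> = v" and E: "y\<^sub>0 \<in> E" "y\<^sub>1 \<in> E"
  shows "fundamental_set D E [:v, 0, -1:] [y\<^sub>0, y\<^sub>1]"
proof -
  have "D (D y\<^sub>0) = v * y\<^sub>0"
    by (simp add: y\<^sub>0 derivation_mult[OF D] ric[symmetric] algebra_simps)
  moreover have "D (D y\<^sub>1) = v * y\<^sub>1"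
    using nz by (simp add: y\<^sub>1 y\<^sub>0 derivation_mult[OF D] derivation_add[OF D]
        derivation_inverse[OF D] ric[symmetric] algebra_simps)
  moreover have "op_apply D [:v, 0, -1:] y = v * y - D (D y)" for y
    by (simp add: op_apply_def numeral_2_eq_2)
  moreover have "c 0 = 0 \<and> c 1 = 0"
    if c: "D (c 0) = 0" "D (c 1) = 0" and sum: "c 0 * y\<^sub>0 + c 1 * y\<^sub>1 = 0" for c :: "nat \<Rightarrow> _"
  proof -
    \<comment> \<open>Dividing by \<open>y\<^sub>0\<close> and differentiating leaves only the multiple of the primitive.\<close>
    have "c 0 + c 1 * (y\<^sub>1 * inverse y\<^sub>0) = (c 0 * y\<^sub>0 + c 1 * y\<^sub>1) * inverse y\<^sub>0"
      using nz by (simp add: field_simps)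
    hence "D (c 0 + c 1 * (y\<^sub>1 * inverse y\<^sub>0)) = 0"
      using sum by (simp add: derivation_0[OF D])
    hence "c 1 * (inverse y\<^sub>0 * inverse y\<^sub>0) = 0"
      by (simp only: derivation_add[OF D] derivation_mult[OF D, of "c 1"] c
          derivation_quotient_solutions[OF D nz y\<^sub>0 y\<^sub>1] mult_zero_left add_0)
    thus ?thesis using sum nz by auto
  qed
  ultimately show ?thesis
    using E by (simp add: fundamental_set_def constants_in_def numeral_2_eq_2 less_Suc_eq all_conj_distrib)
qed

theorem theorem5p4:
  fixes D :: "'a::field_char_0 \<Rightarrow> 'a"
    and D' :: "'b::field_char_0 \<Rightarrow> 'b"
    and \<iota> :: "'a \<Rightarrow> 'b"
    and C K :: "'a set"
    and u l\<^sub>0 \<phi>\<^sub>0 :: 'a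
    and s :: nat
    and L A R :: "'a poly"
    and y\<^sub>0 y\<^sub>1 :: 'b
  assumes "derivation D"
    and "C = constants D" and "alg_closed_set C"
    and "u \<notin> C" and "L = schroedinger u" and "algebro_geometric D L"
    and "is_partner D L s A R"
    and "K = diff_adjoin D C {u}"
    and "(l\<^sub>0, 0) \<in> spectral_zeros D R"
    and "\<phi>\<^sub>0 \<in> K" and "is_gcrd D K [:- \<phi>\<^sub>0, 1:] (L - [:l\<^sub>0:]) (A - [:0:])"
    and "derivation D'" and "diff_embedding D D' K \<iota>" and "differential_closure D' (\<iota> ` K)"
    and "y\<^sub>0 \<noteq> 0" and "op_apply D' [:- \<iota> \<phi>\<^sub>0, 1:] y\<^sub>0 = 0"
    and "y\<^sub>1 \<noteq> 0" and "D' y\<^sub>1 - \<iota> \<phi>\<^sub>0 * y\<^sub>1 = inverse y\<^sub>0"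
  shows "\<iota> ` K \<subseteq> diff_adjoin D' (\<iota> ` K) {y\<^sub>0} \<and>
         diff_adjoin D' (\<iota> ` K) {y\<^sub>0} \<subseteq> diff_adjoin D' (\<iota> ` K) {y\<^sub>0, y\<^sub>1} \<and>
         liouvillian_extension D' (\<iota> ` K) (diff_adjoin D' (\<iota> ` K) {y\<^sub>0}) \<and>
         liouvillian_extension D' (diff_adjoin D' (\<iota> ` K) {y\<^sub>0})
           (diff_adjoin D' (\<iota> ` K) {y\<^sub>0, y\<^sub>1}) \<and>
         constants_in D' (\<iota> ` K) = \<iota> ` C \<and>
         constants_in D' (diff_adjoin D' (\<iota> ` K) {y\<^sub>0}) = \<iota> ` C \<and>
         constants_in D' (diff_adjoin D' (\<iota> ` K) {y\<^sub>0, y\<^sub>1}) = \<iota> ` C \<and>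
         picard_vessiot D' (\<iota> ` K) (map_poly \<iota> (L - [:l\<^sub>0:]))
           (diff_adjoin D' (\<iota> ` K) {y\<^sub>0, y\<^sub>1})"
proof -
  note D = \<open>derivation D\<close> and D' = \<open>derivation D'\<close> and emb = \<open>diff_embedding D D' K \<iota>\<close>
  let ?F = "\<iota> ` K"
  let ?M = "diff_adjoin D' ?F {y\<^sub>0}" and ?E = "diff_adjoin D' ?F {y\<^sub>0, y\<^sub>1}"
  have K: "diff_subfield D K"
    unfolding \<open>K = diff_adjoin D C {u}\<close> by (rule diff_subfield_diff_adjoin)
  hence subK: "is_subfield K" by (simp add: diff_subfield_def)
  have CK: "C \<subseteq> K" and uK: "u \<in> K"
    unfolding \<open>K = diff_adjoin D C {u}\<close> using diff_adjoin_superset(2)[of "{u}" D C]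
    by (auto intro: diff_adjoin_superset(1)[THEN subsetD])
  have F: "diff_subfield D' ?F"
    using \<open>differential_closure D' ?F\<close> by (simp add: differential_closure_def)

  have "constants_in D K = C"
    using CK \<open>C = constants D\<close> by (auto simp: constants_in_def)
  hence constF: "constants_in D' ?F = \<iota> ` C"
    using constants_in_image[OF emb K] by simp
  have "0 \<in> C" using \<open>C = constants D\<close> derivation_0[OF D] by (simp add: constants_in_def)
  hence "alg_closed_set (constants_in D' ?F)"
    unfolding constF using alg_closed_set_image[OF emb subK CK _ \<open>alg_closed_set C\<close>] by blast
  hence "constants D' = \<iota> ` C"
    using constants_differential_closure[OF D' \<open>differential_closure D' ?F\<close>] constF by blast
  hence const: "constants_in D' E = \<iota> ` C" if "?F \<subseteq> E" for E
    using that CK by (auto simp: constants_in_def)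

  have "l\<^sub>0 \<in> K"
    using \<open>(l\<^sub>0, 0) \<in> spectral_zeros D R\<close> \<open>C = constants D\<close> CK by (auto simp: spectral_zeros_def)
  hence vK: "u - l\<^sub>0 \<in> K" using uK subfieldD(3,5)[OF subK] by (metis diff_conv_add_uminus)
  have op: "L - [:l\<^sub>0:] = [:u - l\<^sub>0, 0, -1:]" using \<open>L = schroedinger u\<close> by (simp add: schroedinger_def)
  have "right_divides D K [:- \<phi>\<^sub>0, 1:] [:u - l\<^sub>0, 0, -1:]"
    using \<open>is_gcrd D K [:- \<phi>\<^sub>0, 1:] (L - [:l\<^sub>0:]) (A - [:0:])\<close> op by (simp add: is_gcrd_def)
  hence "D \<phi>\<^sub>0 + \<phi>\<^sub>0 * \<phi>\<^sub>0 = u - l\<^sub>0" by (rule riccati_of_right_divides[OF D])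
  hence "\<iota> (D \<phi>\<^sub>0 + \<phi>\<^sub>0 * \<phi>\<^sub>0) = \<iota> (u - l\<^sub>0)" by simp
  hence ric: "D' (\<iota> \<phi>\<^sub>0) + \<iota> \<phi>\<^sub>0 * \<iota> \<phi>\<^sub>0 = \<iota> (u - l\<^sub>0)"
    using \<open>\<phi>\<^sub>0 \<in> K\<close> K subK by (simp add: diff_embeddingD[OF emb] subfieldD diff_subfield_def)
  have op': "map_poly \<iota> (L - [:l\<^sub>0:]) = [:\<iota> (u - l\<^sub>0), 0, -1:]"
    using subK by (simp add: op map_poly_pCons diff_embedding_0[OF emb] diff_embedding_minus[OF emb]
        subfieldD diff_embeddingD(1)[OF emb])

  have y0: "D' y\<^sub>0 = \<iota> \<phi>\<^sub>0 * y\<^sub>0"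
    using \<open>op_apply D' [:- \<iota> \<phi>\<^sub>0, 1:] y\<^sub>0 = 0\<close> by (simp add: op_apply_def)
  have y1: "D' y\<^sub>1 = \<iota> \<phi>\<^sub>0 * y\<^sub>1 + inverse y\<^sub>0"
    using \<open>D' y\<^sub>1 - \<iota> \<phi>\<^sub>0 * y\<^sub>1 = inverse y\<^sub>0\<close> by (simp add: algebra_simps)
  have sup: "?F \<subseteq> ?M" "?F \<subseteq> ?E" by (rule diff_adjoin_superset)+
  have "y\<^sub>0 \<in> ?E" "y\<^sub>1 \<in> ?E" using diff_adjoin_superset(2)[of "{y\<^sub>0, y\<^sub>1}" D' ?F] by auto
  hence fund: "fundamental_set D' ?E (map_poly \<iota> (L - [:l\<^sub>0:])) [y\<^sub>0, y\<^sub>1]"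
    unfolding op' by (rule fundamental_set_of_riccati[OF D' \<open>y\<^sub>0 \<noteq> 0\<close> y0 y1 ric])
  have "picard_vessiot D' ?F (map_poly \<iota> (L - [:l\<^sub>0:])) ?E"
    unfolding picard_vessiot_def
  proof (intro conjI exI[of _ "[y\<^sub>0, y\<^sub>1]"])
    show "constants_in D' ?E = constants_in D' ?F" using const sup constF by simp
  qed (use fund in simp_all)
  moreover have "liouvillian_extension D' ?F ?M"
    using \<open>y\<^sub>0 \<noteq> 0\<close> \<open>\<phi>\<^sub>0 \<in> K\<close> y0 by (intro liouvillian_extension_hyperexponential[OF D' F]) auto
  moreover have "liouvillian_extension D' ?M ?E"
    by (rule liouvillian_extension_second_solution[OF D' \<open>y\<^sub>0 \<noteq> 0\<close> y0 y1])
  moreover have "?M \<subseteq> ?E" by (rule diff_adjoin_mono) simp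
  ultimately show ?thesis using sup const constF by blast
qed

end
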